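(* Let $G$ be a finite simple graph with maximum degree $\Delta(G)\le 2$, and write $d_v\coloneqq\deg_G(v)$. Then for every antiferromagnetic edge-weighted graph $H$, \[ \hom(G,H)\ \ge\ \prod_{v\in V(G)}\hom(K_{d_v+1},H)^{\frac{1}{d_v+1}}. \]
   Context: An edge-weighted graph $H$ (loops allowed) on a finite vertex set is given by a symmetric matrix of nonnegative weights $H(a,b)$, $a,b\in V(H)$. For a graph $G$, $\hom(G,H)\coloneqq\sum_{\phi:V(G)\to V(H)}\prod_{uv\in E(G)}H(\phi(u),\phi(v))$. $H$ is antiferromagnetic if its weight matrix has exactly one positive eigenvalue, counting multiplicity. $K_m$ is the complete graph on $m$ vertices. *)

theory Defs
  imports Complex_Main "HOL-Library.FuncSet" "HOL-Library.Countable_Set"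
    "Jordan_Normal_Form.Char_Poly"
begin

text \<open>A graph is given by its vertex set \<open>V\<close> and its set \<open>E\<close> of edges, an edge being the
  two-element set of its endpoints.\<close>

definition simple_graph :: "'a set \<Rightarrow> 'a set set \<Rightarrow> bool" where
  "simple_graph V E \<longleftrightarrow> finite V \<and> (\<forall>e\<in>E. e \<subseteq> V \<and> card e = 2)"

definition vertex_degree :: "'a set set \<Rightarrow> 'a \<Rightarrow> nat" where
  "vertex_degree E v = card {e \<in> E. v \<in> e}"

text \<open>The inserted \<open>0\<close> only matters for the graph without vertices.\<close>

definition max_degree :: "'a set \<Rightarrow> 'a set set \<Rightarrow> nat" where
  "max_degree V E = Max (insert 0 (vertex_degree E ` V))"

definition complete_edges :: "nat \<Rightarrow> nat set set" where
  "complete_edges m = {e. e \<subseteq> {..<m} \<and> card e = 2}"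

definition edge_weighted_graph :: "'b set \<Rightarrow> ('b \<Rightarrow> 'b \<Rightarrow> real) \<Rightarrow> bool" where
  "edge_weighted_graph W H \<longleftrightarrow> finite W \<and>
     (\<forall>a\<in>W. \<forall>b\<in>W. H a b = H b a) \<and> (\<forall>a\<in>W. \<forall>b\<in>W. H a b \<ge> 0)"

text \<open>The factor \<open>H (\<phi> u) (\<phi> v)\<close> of the edge \<open>e = {u, v}\<close>; the description is proper because
  the weights are symmetric, see \<open>edge_factor_doubleton\<close>.\<close>

definition edge_factor :: "('b \<Rightarrow> 'b \<Rightarrow> real) \<Rightarrow> ('a \<Rightarrow> 'b) \<Rightarrow> 'a set \<Rightarrow> real" where
  "edge_factor H \<phi> e = (THE w. \<exists>u v. e = {u, v} \<and> w = H (\<phi> u) (\<phi> v))"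

lemma edge_factor_doubleton:
  assumes "u \<noteq> v" "H (\<phi> u) (\<phi> v) = H (\<phi> v) (\<phi> u)"
  shows "edge_factor H \<phi> {u, v} = H (\<phi> u) (\<phi> v)"
  unfolding edge_factor_def
  by (rule the_equality) (use assms in \<open>auto simp: doubleton_eq_iff\<close>)

text \<open>Vertex maps are taken to be \<open>undefined\<close> outside \<open>V\<close>, so that each map from \<open>V\<close> to \<open>W\<close>
  is counted once.\<close>

definition hom_weight :: "'a set \<Rightarrow> 'a set set \<Rightarrow> 'b set \<Rightarrow> ('b \<Rightarrow> 'b \<Rightarrow> real) \<Rightarrow> real" where
  "hom_weight V E W H = (\<Sum>\<phi> \<in> V \<rightarrow>\<^sub>E W. \<Prod>e\<in>E. edge_factor H \<phi> e)"

text \<open>The vertices are enumerated by the bijection \<open>from_nat_into W\<close> from \<open>{..<card W}\<close> to the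
  finite set \<open>W\<close>; another enumeration conjugates the matrix by a permutation and leaves its
  spectrum unchanged.\<close>

definition weight_matrix :: "'b set \<Rightarrow> ('b \<Rightarrow> 'b \<Rightarrow> real) \<Rightarrow> real mat" where
  "weight_matrix W H =
     mat (card W) (card W) (\<lambda>(i, j). H (from_nat_into W i) (from_nat_into W j))"

definition num_pos_eigenvalues :: "real mat \<Rightarrow> nat" where
  "num_pos_eigenvalues A = (\<Sum>x | eigenvalue A x \<and> x > 0. order x (char_poly A))"

definition antiferromagnetic :: "'b set \<Rightarrow> ('b \<Rightarrow> 'b \<Rightarrow> real) \<Rightarrow> bool" where
  "antiferromagnetic W H \<longleftrightarrow> num_pos_eigenvalues (weight_matrix W H) = 1"

end

theory Submission
  imports Defs "Jordan_Normal_Form.Schur_Decomposition"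
begin

text \<open>Every component of \<open>G\<close> is a path or a cycle, and both sides of the inequality are
  multiplicative over components. Let \<open>A\<close> be the weight matrix, \<open>x > 0\<close> its only positive eigenvalue
  and \<open>- y\<^sub>i \<le> 0\<close> the other ones, and put \<open>t = (tr A\<^sup>3)\<^bsup>1/3\<^esup>\<close>.
  Since \<open>tr A\<^sup>3 \<ge> 0\<close>, the identity \<open>t\<^sup>3 + \<Sum>\<^sub>i y\<^sub>i\<^sup>3 = x\<^sup>3\<close> gives \<open>t \<le> x\<close> and \<open>y\<^sub>i \<le> x\<close>.
  A cycle with \<open>m\<close> vertices needs \<open>t\<^sup>m \<le> tr A\<^sup>m\<close>, which follows by multiplying this identity by
  \<open>x\<^bsup>m-3\<^esup>\<close> and using \<open>t \<le> x\<close>, \<open>y\<^sub>i \<le> x\<close>. A path with \<open>m + 2\<close> vertices needs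
  \<open>(1\<^sup>T A 1) t\<^sup>m \<le> 1\<^sup>T A\<^bsup>m+1\<^esup> 1\<close>. With \<open>c\<close> and \<open>c\<^sub>i\<close> the squared coordinates of
  the all-ones vector \<open>1\<close> in an orthonormal eigenbasis, this follows from
  \<open>\<Sum>\<^sub>i c\<^sub>i y\<^sub>i (y\<^sub>i\<^sup>m - t\<^sup>m) \<le> \<Sum>\<^sub>i c\<^sub>i y\<^sub>i (x\<^sup>m - t\<^sup>m) \<le> c x (x\<^sup>m - t\<^sup>m)\<close>,
  where the last step is \<open>1\<^sup>T A 1 \<ge> 0\<close>.\<close>

section \<open>Diagonalization of real symmetric matrices\<close>

text \<open>Over the complex numbers the characteristic polynomial has a root \<open>z\<close>, with
  an eigenvector \<open>v\<close>. As the matrix is real and symmetric, moving it across the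
  Hermitian product \<open>v \<bullet>c v\<close> turns the factor \<open>z\<close> into its
  conjugate. So \<open>z\<close> is real, and it is a root of the real characteristic polynomial as
  well.\<close>

lemma symmetric_mat_real_eigenvector:
  fixes A :: "real mat"
  assumes A: "A \<in> carrier_mat n n" and sym: "transpose_mat A = A" and n: "n > 0"
  obtains e v where "eigenvector A v e"
proof -
  let ?C = "map_mat complex_of_real A"
  have C: "?C \<in> carrier_mat n n" using A by simp
  obtain as where as: "char_poly ?C = (\<Prod>a\<leftarrow>as. [:- a, 1:])" "length as = n"
    using char_poly_factorized[OF C] by blast
  then obtain z where "z \<in> set as" using n by (cases as) auto
  hence z0: "poly (char_poly ?C) z = 0"
    unfolding as poly_prod_list by (induction as) auto
  then obtain v where v: "v \<in> carrier_vec n" "v \<noteq> 0\<^sub>v n" "?C *\<^sub>v v = z \<cdot>\<^sub>v v"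
    using eigenvalue_root_char_poly[OF C] C unfolding eigenvalue_def eigenvector_def by auto
  have cv: "conjugate v \<in> carrier_vec n" using v by simp
  have cC: "conjugate (?C *\<^sub>v v) = ?C *\<^sub>v conjugate v"
    using A v(1) by (intro eq_vecI) (auto simp: scalar_prod_def)
  have tC: "transpose_mat ?C = ?C"
    using sym by (metis map_mat_transpose)
  have "z * (v \<bullet>c v) = (?C *\<^sub>v v) \<bullet>c v" using v by simp
  also have "\<dots> = v \<bullet> (?C *\<^sub>v conjugate v)"
    using transpose_vec_mult_scalar[OF C cv v(1)] tC by simp
  also have "\<dots> = v \<bullet>c (z \<cdot>\<^sub>v v)" using cC v(3) by simp
  also have "\<dots> = cnj z * (v \<bullet>c v)" using v(1) by (simp add: conjugate_smult_vec)
  finally have "z = cnj z" using v by auto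
  then obtain r where r: "z = complex_of_real r"
    by (metis Reals_cnj_iff Reals_cases)
  have "complex_of_real (poly (char_poly A) r) = poly (char_poly ?C) z"
    unfolding r by (simp add: of_real_hom.char_poly_hom[OF A])
  hence "poly (char_poly A) r = 0" using z0 by simp
  thus ?thesis using that eigenvalue_root_char_poly[OF A] unfolding eigenvalue_def by blast
qed

text \<open>Gram-Schmidt applied to a basis that starts with \<open>v\<close> keeps \<open>v\<close>
  in front. Dividing each vector by its length then gives the columns of \<open>W\<close>. The
  factor \<open>c\<close> is that normalization of \<open>v\<close>.\<close>

lemma orthonormal_completion:
  fixes v :: "real vec"
  assumes v: "v \<in> carrier_vec n" and v0: "v \<noteq> 0\<^sub>v n"
  obtains W :: "real mat" and c where "W \<in> carrier_mat n n" "transpose_mat W * W = 1\<^sub>m n" "col W 0 = c \<cdot>\<^sub>v v"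
proof -
  interpret cof_vec_space n "TYPE(real)" .
  define b where "b = basis_completion v"
  define ws where "ws = gram_schmidt n b"
  note bc = basis_completion[OF v v0, folded b_def]
  note gs = gram_schmidt_result[OF bc(2,4,5) refl, folded ws_def]
  have n: "n > 0" using v v0 by (cases n) auto
  have "b = v # tl b" using bc(6,7) n by (cases b) auto
  hence "hd ws = v" using gram_schmidt_hd[OF v, of "tl b"] ws_def by simp
  hence ws0: "ws ! 0 = v" using gs(4) bc(6) n by (cases ws) auto
  have len: "length ws = n" using gs(4) bc(6) by simp
  have wsc: "ws ! i \<in> carrier_vec n" if "i < n" for i using gs(3) len that by auto
  \<comment> \<open>The case \<open>i = j\<close> says that no vector has norm zero, which permits
    the division by the lengths.\<close>
  have orth: "ws ! i \<bullet> ws ! j = 0 \<longleftrightarrow> i \<noteq> j" if "i < n" "j < n" for i j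
    using corthogonalD[OF gs(2), of i j] len that by simp
  have nn: "ws ! i \<bullet> ws ! i \<ge> 0" for i
    unfolding scalar_prod_def by (intro sum_nonneg) auto
  define us where "us = map (\<lambda>w. (1 / sqrt (w \<bullet> w)) \<cdot>\<^sub>v w) ws"
  define W where "W = mat_of_cols n us"
  have W: "W \<in> carrier_mat n n" unfolding W_def us_def using len by (metis length_map mat_of_cols_carrier(1))
  have col: "col W i = (1 / sqrt (ws ! i \<bullet> ws ! i)) \<cdot>\<^sub>v ws ! i" if "i < n" for i
    unfolding W_def using that wsc[OF that] len by (subst col_mat_of_cols) (auto simp: us_def)
  have "transpose_mat W * W = 1\<^sub>m n"
  proof (rule eq_matI, goal_cases)
    case (1 i j)
    hence ij: "i < n" "j < n" by auto
    have "(transpose_mat W * W) $$ (i, j) = col W i \<bullet> col W j" using ij W by simp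
    also have "\<dots> = 1 / (sqrt (ws ! i \<bullet> ws ! i) * sqrt (ws ! j \<bullet> ws ! j)) * (ws ! i \<bullet> ws ! j)"
      unfolding col[OF ij(1)] col[OF ij(2)]
      using wsc[OF ij(1)] wsc[OF ij(2)] by simp
    also have "\<dots> = (if i = j then 1 else 0)"
      using orth ij nn[of i] by (auto simp flip: real_sqrt_mult)
    finally show ?case using ij by simp
  qed (use W in auto)
  moreover have "col W 0 = (1 / sqrt (v \<bullet> v)) \<cdot>\<^sub>v v" using col[OF n] ws0 by simp
  ultimately show ?thesis using that W by blast
qed

text \<open>Deflation: conjugation by an orthogonal matrix whose first column is an eigenvector
  clears the first row and column outside the diagonal. The remaining block is symmetric and one
  size smaller, so induction applies to it.\<close>

theorem symmetric_mat_diagonalizable: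
  fixes A :: "real mat"
  assumes "A \<in> carrier_mat n n" and "transpose_mat A = A"
  shows "\<exists>P d. P \<in> carrier_mat n n \<and> transpose_mat P * P = 1\<^sub>m n \<and>
           A = P * mat_diag n d * transpose_mat P"
  using assms
proof (induction n arbitrary: A)
  case 0
  show ?case
    by (rule exI[of _ "1\<^sub>m 0"]) (use 0 in \<open>auto intro!: eq_matI\<close>)
next
  case (Suc m)
  let ?n = "Suc m"
  note A = Suc.prems(1)
  obtain e v where ev: "eigenvector A v e"
    using symmetric_mat_real_eigenvector[OF Suc.prems] by blast
  hence v: "v \<in> carrier_vec ?n" "v \<noteq> 0\<^sub>v ?n" "A *\<^sub>v v = e \<cdot>\<^sub>v v"
    using A unfolding eigenvector_def by auto
  obtain W c where W: "W \<in> carrier_mat ?n ?n" and WW: "transpose_mat W * W = 1\<^sub>m ?n"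
    and W0: "col W 0 = c \<cdot>\<^sub>v v"
    using orthonormal_completion[OF v(1,2)] by blast
  let ?T = "transpose_mat W"
  have T: "?T \<in> carrier_mat ?n ?n" using W by simp
  have WT: "W * ?T = 1\<^sub>m ?n" using mat_mult_left_right_inverse[OF T W WW] .
  define B where "B = ?T * A * W"
  have B: "B \<in> carrier_mat ?n ?n" unfolding B_def using W A by auto
  have tB: "transpose_mat B = B"
    unfolding B_def using W A T Suc.prems(2)
    by (simp add: transpose_mult[of _ ?n ?n _ ?n] assoc_mult_mat[of _ ?n ?n _ ?n _ ?n])
  have AB: "A = W * B * ?T"
  proof -
    have "W * B * ?T = (W * ?T) * A * (W * ?T)"
      unfolding B_def using W A T by (simp add: assoc_mult_mat[of _ ?n ?n _ ?n _ ?n])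
    thus ?thesis using WT A by simp
  qed
  have Bi0: "B $$ (i, 0) = (if i = 0 then e else 0)" if "i < ?n" for i
  proof -
    have "B = ?T * (A * W)" unfolding B_def using W A T by simp
    hence "B $$ (i, 0) = col W i \<bullet> col (A * W) 0" using that W A by simp
    also have "col (A * W) 0 = A *\<^sub>v col W 0" using W A by (intro col_mult2[of _ ?n ?n _ ?n]) auto
    also have "\<dots> = e \<cdot>\<^sub>v col W 0"
      unfolding W0 using v A by (simp add: mult_mat_vec[of _ ?n ?n] smult_smult_assoc mult.commute)
    also have "col W i \<bullet> (e \<cdot>\<^sub>v col W 0) = e * (col W i \<bullet> col W 0)" using W that by (intro scalar_prod_smult_right) auto
    also have "col W i \<bullet> col W 0 = (?T * W) $$ (i, 0)" using that W by simp
    finally show ?thesis unfolding WW using that by simp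
  qed
  have B0i: "B $$ (0, i) = (if i = 0 then e else 0)" if "i < ?n" for i
    using Bi0[OF that] tB B that by (metis carrier_matD(1,2) index_transpose_mat(1) zero_less_Suc)
  define B' where "B' = mat m m (\<lambda>(i, j). B $$ (Suc i, Suc j))"
  have B': "B' \<in> carrier_mat m m" unfolding B'_def by simp
  have "transpose_mat B' = B'"
  proof (rule eq_matI, goal_cases)
    case (1 i j)
    hence "B $$ (Suc j, Suc i) = transpose_mat B $$ (Suc i, Suc j)" using B B' by auto
    thus ?case using 1 B' unfolding tB by (auto simp: B'_def)
  qed (use B' in auto)
  then obtain P d where P: "P \<in> carrier_mat m m" "transpose_mat P * P = 1\<^sub>m m"
    and PB: "B' = P * mat_diag m d * transpose_mat P"
    using Suc.IH[OF B'] by blast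
  let ?o = "1\<^sub>m 1 :: real mat" and ?zr = "0\<^sub>m 1 m :: real mat" and ?zc = "0\<^sub>m m 1 :: real mat"
  let ?E = "mat 1 1 (\<lambda>_. e)"
  \<comment> \<open>\<open>Q\<close> fixes the first coordinate and acts by the inductively given
    \<open>P\<close> on the others. The matrix that diagonalizes \<open>A\<close> will be
    \<open>W * Q\<close>.\<close>
  define Q where "Q = four_block_mat ?o ?zr ?zc P"
  define D where "D = mat_diag ?n (case_nat e d)"
  have Q: "Q \<in> carrier_mat ?n ?n" unfolding Q_def using P by auto
  have D: "D \<in> carrier_mat ?n ?n" unfolding D_def by auto
  have tQ: "transpose_mat Q = four_block_mat ?o ?zr ?zc (transpose_mat P)"
    unfolding Q_def using P by (subst transpose_four_block_mat) auto
  have Deq: "D = four_block_mat ?E ?zr ?zc (mat_diag m d)"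
    unfolding D_def mat_diag_def by (rule eq_matI) (auto split: nat.splits)
  have QQ: "transpose_mat Q * Q = 1\<^sub>m ?n"
    unfolding tQ unfolding Q_def using P
    by (subst mult_four_block_mat[of _ 1 1 _ m _ m _ _ 1 _ m]) (auto)
  have QD: "Q * D = four_block_mat ?E ?zr ?zc (P * mat_diag m d)"
    unfolding Q_def Deq using P left_mult_zero_mat[of "mat_diag m d" m m 1]
    by (subst mult_four_block_mat[of _ 1 1 _ m _ m _ _ 1 _ m]) (auto)
  have "Q * D * transpose_mat Q = four_block_mat ?E ?zr ?zc B'"
    unfolding QD tQ PB using P left_mult_zero_mat[of "transpose_mat P" m m 1]
      right_mult_zero_mat[of "P * mat_diag m d" m m 1] left_add_zero_mat[of "P * mat_diag m d * transpose_mat P" m m]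
    by (subst mult_four_block_mat[of _ 1 1 _ m _ m _ _ 1 _ m]) (auto)
  also have "\<dots> = B"
    by (rule eq_matI) (use B in \<open>auto simp: B'_def Bi0 B0i\<close>)
  finally have BQ: "B = Q * D * transpose_mat Q" ..
  have tWQ: "transpose_mat (W * Q) = transpose_mat Q * ?T" by (rule transpose_mult[OF W Q])
  have tq: "transpose_mat Q \<in> carrier_mat ?n ?n" using Q by simp
  have "transpose_mat (W * Q) * (W * Q) = transpose_mat Q * ((?T * W) * Q)"
    unfolding tWQ using W Q T tq by (simp add: assoc_mult_mat[of _ ?n ?n _ ?n _ ?n])
  hence 1: "transpose_mat (W * Q) * (W * Q) = 1\<^sub>m ?n" unfolding WW using QQ Q by simp
  have 2: "A = (W * Q) * D * transpose_mat (W * Q)"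
    unfolding AB BQ tWQ using W Q T tq D by (simp add: assoc_mult_mat[of _ ?n ?n _ ?n _ ?n])
  show ?case using 1 2 W Q unfolding D_def by (intro exI[of _ "W * Q"] exI[of _ "case_nat e d"]) auto
qed

text \<open>By similarity the characteristic polynomial is the product of the factors
  \<open>[:- d i, 1:]\<close>, so the order of a root \<open>x\<close> is the number of indices with
  \<open>d i = x\<close>. Grouping the indices with \<open>d i > 0\<close> by the value of
  \<open>d\<close> gives the count.\<close>

lemma num_pos_eigenvalues_diagonalized:
  fixes P :: "real mat"
  assumes P: "P \<in> carrier_mat n n" and PP: "transpose_mat P * P = 1\<^sub>m n"
    and A: "A = P * mat_diag n d * transpose_mat P"
  shows "num_pos_eigenvalues A = card {i. i < n \<and> d i > 0}"
proof -
  have T: "transpose_mat P \<in> carrier_mat n n" using P by simp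
  have D: "mat_diag n d \<in> carrier_mat n n" by simp
  have Ac: "A \<in> carrier_mat n n" unfolding A using P T by auto
  have "similar_mat A (mat_diag n d)"
    unfolding similar_mat_def
    by (intro exI, rule similar_mat_witI[OF mat_mult_left_right_inverse[OF T P PP] PP A Ac D P T])
  moreover have "upper_triangular (mat_diag n d)" by (auto simp: mat_diag_def)
  ultimately have cp: "char_poly A = (\<Prod>a\<leftarrow>diag_mat (mat_diag n d). [:- a, 1:])"
    using char_poly_similar char_poly_upper_triangular[OF D] by metis
  have "diag_mat (mat_diag n d) = map d [0..<n]"
    by (simp add: diag_mat_def mat_diag_def)
  hence cp: "char_poly A = (\<Prod>i<n. [:- d i, 1:])"
    unfolding cp by (simp add: prod.list_conv_set_nth atLeast0LessThan)
  have ne: "(\<Prod>i\<in>I. [:- d i, 1:]) \<noteq> 0" if "finite I" for I using that by (simp)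
  have ord: "Polynomial.order x (\<Prod>i\<in>I. [:- d i, 1:]) = card {i\<in>I. d i = x}" if "finite I" for x I
    using that
  proof (induction I)
    case (insert j I)
    have "Polynomial.order x ([:- d j, 1:] * (\<Prod>i\<in>I. [:- d i, 1:])) = Polynomial.order x [:- d j, 1:] + card {i\<in>I. d i = x}"
      using insert ne[of "insert j I"] by (subst order_mult) auto
    moreover have "Polynomial.order x [:- d j, 1:] = (if d j = x then 1 else 0)"
      using order_power_n_n[of x 1] by (auto simp: order_0I)
    moreover have "{i\<in>insert j I. d i = x} = (if d j = x then insert j {i\<in>I. d i = x} else {i\<in>I. d i = x})" by auto
    ultimately show ?case using insert by (simp)
  qed (simp add: order_0I)
  have ev: "{x. eigenvalue A x \<and> x > 0} = d ` {i. i < n \<and> d i > 0}"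
    unfolding eigenvalue_root_char_poly[OF Ac] cp poly_prod by auto
  have "num_pos_eigenvalues A = (\<Sum>x\<in>d ` {i. i < n \<and> d i > 0}. card {i. i < n \<and> d i = x})"
    unfolding num_pos_eigenvalues_def ev unfolding cp by (simp add: ord)
  also have "\<dots> = (\<Sum>x\<in>d ` {i. i < n \<and> d i > 0}. \<Sum>i\<in>{i \<in> {i. i < n \<and> d i > 0}. d i = x}. 1)"
    by (auto intro!: sum.cong arg_cong[where f = card])
  also have "\<dots> = card {i. i < n \<and> d i > 0}"
    by (subst sum.image_gen[symmetric]) auto
  finally show ?thesis .
qed

section \<open>Homomorphism sums of paths and cycles\<close>

lemma edge_factor_cong:
  assumes "\<And>v. v \<in> e \<Longrightarrow> \<phi> v = \<psi> v"
  shows "edge_factor H \<phi> e = edge_factor H \<psi> e"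
proof -
  have "(\<exists>u v. e = {u, v} \<and> w = H (\<phi> u) (\<phi> v)) \<longleftrightarrow> (\<exists>u v. e = {u, v} \<and> w = H (\<psi> u) (\<psi> v))" for w
    using assms by (metis insert_iff)
  thus ?thesis unfolding edge_factor_def by simp
qed

lemma sum_PiE_insert:
  assumes "x \<notin> S"
  shows "(\<Sum>\<phi>\<in>insert x S \<rightarrow>\<^sub>E W. f \<phi>) = (\<Sum>a\<in>W. \<Sum>g\<in>S \<rightarrow>\<^sub>E W. f (g(x := a)))"
proof -
  have "inj_on (\<lambda>(y, g). g(x := y)) (W \<times> (S \<rightarrow>\<^sub>E W))"
    using inj_combinator[OF assms, of "\<lambda>_. W"] by simp
  thus ?thesis
    by (simp add: PiE_insert_eq sum.reindex sum.cartesian_product case_prod_unfold)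
qed

text \<open>A map on a disjoint union is a pair of maps on the two parts, and each edge factor
  depends on only one of them.\<close>

lemma hom_weight_Un:
  assumes "V1 \<inter> V2 = {}" and "E1 \<subseteq> Pow V1" and "E2 \<subseteq> Pow V2" and "{} \<notin> E1"
    and "finite E1" and "finite E2"
  shows "hom_weight (V1 \<union> V2) (E1 \<union> E2) W H = hom_weight V1 E1 W H * hom_weight V2 E2 W H"
proof -
  let ?j = "\<lambda>(\<phi>, \<psi>) x. if x \<in> V1 then \<phi> x else \<psi> x"
  \<comment> \<open>Only the empty set could belong to both edge sets; \<open>{} \<notin> E1\<close>
    rules it out, so the product over the union splits.\<close>
  have "e = {}" if "e \<in> E1" "e \<in> E2" for e
  proof -
    have "e \<subseteq> V1 \<inter> V2" using that assms(2,3) by auto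
    thus ?thesis using assms(1) by simp
  qed
  hence disj: "E1 \<inter> E2 = {}" using assms(4) by auto
  have *: "(\<Prod>e\<in>E1 \<union> E2. edge_factor H \<phi> e) =
      (\<Prod>e\<in>E1. edge_factor H (restrict \<phi> V1) e) * (\<Prod>e\<in>E2. edge_factor H (restrict \<phi> V2) e)" for \<phi>
  proof -
    have "edge_factor H \<phi> e = edge_factor H (restrict \<phi> U) e" if "E \<subseteq> Pow U" "e \<in> E" for e E U
     by (rule edge_factor_cong) (use that in auto)
    note this[OF assms(2)] this[OF assms(3)]
    thus ?thesis using disj assms(5,6) by (simp add: prod.union_disjoint)
  qed
  have "hom_weight (V1 \<union> V2) (E1 \<union> E2) W H =
      (\<Sum>(\<phi>, \<psi>)\<in>(V1 \<rightarrow>\<^sub>E W) \<times> (V2 \<rightarrow>\<^sub>E W). (\<Prod>e\<in>E1. edge_factor H \<phi> e) * (\<Prod>e\<in>E2. edge_factor H \<psi> e))"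
    unfolding hom_weight_def *
  proof (rule sum.reindex_bij_witness[of _ ?j "\<lambda>\<phi>. (restrict \<phi> V1, restrict \<phi> V2)"], goal_cases)
    case (1 \<phi>)
    thus ?case by (intro ext) (simp add: PiE_def extensional_def)
  next
    case (2 \<phi>)
    thus ?case by (auto simp: restrict_PiE_iff)
  next
    case (3 p)
    obtain \<phi> \<psi> where p: "p = (\<phi>, \<psi>)" by (cases p)
    have "restrict (?j p) V1 = \<phi>" "restrict (?j p) V2 = \<psi>"
      using 3 assms(1) unfolding p by (auto intro!: ext simp: PiE_def extensional_def)
    thus ?case unfolding p by simp
  next
    case (4 p)
    thus ?case by (cases p) (auto simp: PiE_iff extensional_def)
  next
    case (5 \<phi>)
    show ?case by simp
  qed
  also have "\<dots> = hom_weight V1 E1 W H * hom_weight V2 E2 W H"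
    unfolding hom_weight_def sum_product sum.cartesian_product ..
  finally show ?thesis .
qed

text \<open>This is the entry at \<open>(a, b)\<close> of the \<open>m\<close>-th power of the
  weight matrix, indexed directly by \<open>W\<close>: the total weight of the walks with
  \<open>m\<close> edges from \<open>a\<close> to \<open>b\<close>.\<close>

fun walks :: "'b set \<Rightarrow> ('b \<Rightarrow> 'b \<Rightarrow> real) \<Rightarrow> nat \<Rightarrow> 'b \<Rightarrow> 'b \<Rightarrow> real" where
  "walks W H 0 a b = of_bool (a = b)"
| "walks W H (Suc m) a b = (\<Sum>c\<in>W. H a c * walks W H m c b)"

lemma walks_nonneg:
  assumes "\<And>a b. a \<in> W \<Longrightarrow> b \<in> W \<Longrightarrow> H a b \<ge> 0" and "a \<in> W"
  shows "walks W H m a b \<ge> 0"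
  using assms(2) by (induction m arbitrary: a) (auto intro!: sum_nonneg mult_nonneg_nonneg assms(1))

fun path_edges :: "'a list \<Rightarrow> 'a set set" where
  "path_edges (x # y # zs) = insert {x, y} (path_edges (y # zs))"
| "path_edges _ = {}"

lemma path_edges_conv_nth: "path_edges xs = {{xs ! i, xs ! Suc i} |i. Suc i < length xs}"
proof (induction xs rule: path_edges.induct)
  case (1 x y zs)
  let ?f = "\<lambda>i. {(x # y # zs) ! i, (x # y # zs) ! Suc i}"
  have "{?f i |i. Suc i < length (x # y # zs)} = ?f ` {..<Suc (length zs)}" by auto
  also have "\<dots> = insert (?f 0) ((\<lambda>i. ?f (Suc i)) ` {..<length zs})"
    unfolding lessThan_Suc_eq_insert_0 image_insert image_image ..
  also have "(\<lambda>i. ?f (Suc i)) ` {..<length zs} = path_edges (y # zs)"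
    unfolding 1 by auto
  finally show ?case by simp
qed auto

lemma finite_path_edges [simp]: "finite (path_edges xs)"
  by (induction xs rule: path_edges.induct) auto

lemma path_edges_subset: "e \<in> path_edges xs \<Longrightarrow> e \<subseteq> set xs"
  by (auto simp: path_edges_conv_nth)

text \<open>The weight \<open>F\<close> on the images of the two ends lets one induction serve
  twice: a constant \<open>F\<close> gives paths, and \<open>F a b = H b a\<close> closes the path
  to a cycle.\<close>

lemma sum_over_path:
  assumes "distinct xs" and "xs \<noteq> []" and sym: "\<And>a b. a \<in> W \<Longrightarrow> b \<in> W \<Longrightarrow> H a b = H b a" and W: "finite W"
  shows "(\<Sum>\<phi>\<in>set xs \<rightarrow>\<^sub>E W. F (\<phi> (hd xs)) (\<phi> (last xs)) * (\<Prod>e\<in>path_edges xs. edge_factor H \<phi> e)) =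
    (\<Sum>a\<in>W. \<Sum>b\<in>W. F a b * walks W H (length xs - 1) a b)"
  using assms(1,2)
proof (induction xs arbitrary: F rule: path_edges.induct)
  case (1 x y zs)
  let ?S = "set (y # zs)" and ?m = "length (y # zs) - 1"
  have x: "x \<notin> ?S" and d: "distinct (y # zs)" using 1 by auto
  have prod: "(\<Prod>e\<in>path_edges (x # y # zs). edge_factor H (g(x := a)) e) =
      H a (g y) * (\<Prod>e\<in>path_edges (y # zs). edge_factor H g e)"
    if "g \<in> ?S \<rightarrow>\<^sub>E W" "a \<in> W" for g a
  proof -
    have "{x, y} \<notin> path_edges (y # zs)" using path_edges_subset[of "{x, y}" "y # zs"] x by auto
    moreover have "edge_factor H (g(x := a)) {x, y} = H a (g y)"
      using edge_factor_doubleton[of x y H "g(x := a)"] x sym[of a "g y"] PiE_mem[OF that(1), of y] that(2) by auto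
    moreover have "edge_factor H (g(x := a)) e = edge_factor H g e" if "e \<in> path_edges (y # zs)" for e
      by (rule edge_factor_cong) (use path_edges_subset[OF that] x in auto)
    ultimately show ?thesis by simp
  qed
  have last: "(g(x := a)) (last (x # y # zs)) = g (last (y # zs))" for g and a :: 'b
    using x last_in_set[of "y # zs"] by auto
  have "(\<Sum>\<phi>\<in>set (x # y # zs) \<rightarrow>\<^sub>E W. F (\<phi> (hd (x # y # zs))) (\<phi> (last (x # y # zs))) *
          (\<Prod>e\<in>path_edges (x # y # zs). edge_factor H \<phi> e)) =
      (\<Sum>a\<in>W. \<Sum>g\<in>?S \<rightarrow>\<^sub>E W. F a (g (last (y # zs))) * (H a (g y) * (\<Prod>e\<in>path_edges (y # zs). edge_factor H g e)))"
    unfolding list.set(2)[of x] sum_PiE_insert[OF x] last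
    by (intro sum.cong refl) (simp add: prod del: path_edges.simps)
  also have "\<dots> = (\<Sum>g\<in>?S \<rightarrow>\<^sub>E W. (\<Sum>a\<in>W. F a (g (last (y # zs))) * H a (g (hd (y # zs)))) *
      (\<Prod>e\<in>path_edges (y # zs). edge_factor H g e))"
    by (subst sum.swap) (simp add: sum_distrib_right mult.assoc)
  \<comment> \<open>The image \<open>a\<close> of the first vertex has been summed out; its edge is
    absorbed into a new end weight for the shorter path.\<close>
  also have "\<dots> = (\<Sum>c\<in>W. \<Sum>b\<in>W. (\<Sum>a\<in>W. F a b * H a c) * walks W H ?m c b)"
    by (rule "1.IH"[OF d, of "\<lambda>c b. \<Sum>a\<in>W. F a b * H a c"]) simp
  also have "\<dots> = (\<Sum>c\<in>W. \<Sum>a\<in>W. \<Sum>b\<in>W. F a b * H a c * walks W H ?m c b)"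
    unfolding sum_distrib_right by (intro sum.cong refl sum.swap)
  also have "\<dots> = (\<Sum>a\<in>W. \<Sum>c\<in>W. \<Sum>b\<in>W. F a b * H a c * walks W H ?m c b)"
    by (rule sum.swap)
  also have "\<dots> = (\<Sum>a\<in>W. \<Sum>b\<in>W. \<Sum>c\<in>W. F a b * H a c * walks W H ?m c b)"
    by (intro sum.cong refl sum.swap)
  also have "\<dots> = (\<Sum>a\<in>W. \<Sum>b\<in>W. F a b * walks W H (length (x # y # zs) - 1) a b)"
    by (simp add: sum_distrib_left mult.assoc)
  finally show ?case .
next
  \<comment> \<open>A single vertex is both ends of its path, which matches
    \<open>of_bool (a = b)\<close> for walks of length 0.\<close>
  case ("2_2" x)
  show ?case
    unfolding list.set sum_PiE_insert[of x "{}", simplified] by (simp add: sum_PiE_insert W if_distrib[of "\<lambda>t. _ * t"] of_bool_def cong: if_cong)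
qed simp

lemma hom_weight_path:
  assumes "distinct xs" and "xs \<noteq> []" and "edge_weighted_graph W H"
  shows "hom_weight (set xs) (path_edges xs) W H = (\<Sum>a\<in>W. \<Sum>b\<in>W. walks W H (length xs - 1) a b)"
  using sum_over_path[OF assms(1,2), of W H "\<lambda>_ _. 1"] assms(3)
  unfolding hom_weight_def edge_weighted_graph_def by simp

text \<open>From three vertices on, the two ends are not consecutive. Closing the path therefore
  adds a genuine factor to the product and one to the degree of each end.\<close>

lemma closing_edge_notin_path_edges:
  assumes "distinct xs" and "length xs \<ge> 3"
  shows "{hd xs, last xs} \<notin> path_edges xs"
proof
  assume *: "{hd xs, last xs} \<in> path_edges xs"
  have "xs \<noteq> []" using assms(2) by auto
  with * obtain i where i: "Suc i < length xs" "{xs ! 0, xs ! (length xs - 1)} = {xs ! i, xs ! Suc i}"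
    using assms(2) by (auto simp: path_edges_conv_nth hd_conv_nth last_conv_nth)
  moreover from this have "i \<noteq> 0 \<or> Suc i \<noteq> length xs - 1" using assms(2) by auto
  moreover have "0 < length xs" "length xs - 1 < length xs" "i < length xs" using i(1) by auto
  ultimately show False using assms(1) by (auto simp: doubleton_eq_iff nth_eq_iff_index_eq)
qed

lemma hom_weight_cycle:
  assumes "distinct xs" and "length xs \<ge> 3" and "edge_weighted_graph W H"
  shows "hom_weight (set xs) (insert {hd xs, last xs} (path_edges xs)) W H = (\<Sum>a\<in>W. walks W H (length xs) a a)"
proof -
  have ne: "xs \<noteq> []" using assms(2) by auto
  hence hl: "hd xs \<noteq> last xs"
    using assms(1,2) by (auto simp: hd_conv_nth last_conv_nth nth_eq_iff_index_eq)
  have sym: "\<And>a b. a \<in> W \<Longrightarrow> b \<in> W \<Longrightarrow> H a b = H b a" and W: "finite W"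
    using assms(3) unfolding edge_weighted_graph_def by auto
  have "hom_weight (set xs) (insert {hd xs, last xs} (path_edges xs)) W H =
      (\<Sum>\<phi>\<in>set xs \<rightarrow>\<^sub>E W. H (\<phi> (last xs)) (\<phi> (hd xs)) * (\<Prod>e\<in>path_edges xs. edge_factor H \<phi> e))"
    unfolding hom_weight_def
  proof (rule sum.cong[OF refl])
    fix \<phi> assume "\<phi> \<in> set xs \<rightarrow>\<^sub>E W"
    hence "H (\<phi> (hd xs)) (\<phi> (last xs)) = H (\<phi> (last xs)) (\<phi> (hd xs))"
      using ne by (intro sym) auto
    thus "(\<Prod>e\<in>insert {hd xs, last xs} (path_edges xs). edge_factor H \<phi> e) =
        H (\<phi> (last xs)) (\<phi> (hd xs)) * (\<Prod>e\<in>path_edges xs. edge_factor H \<phi> e)"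
      using closing_edge_notin_path_edges[OF assms(1,2)] edge_factor_doubleton[OF hl, of H \<phi>] by simp
  qed
  \<comment> \<open>With the closing edge written as \<open>H b a\<close>, it precedes a walk from
    \<open>a\<close> to \<open>b\<close>, so the sum over \<open>a\<close> is one step of the
    recursion of \<open>walks\<close>.\<close>
  also have "\<dots> = (\<Sum>a\<in>W. \<Sum>b\<in>W. H b a * walks W H (length xs - 1) a b)"
    by (rule sum_over_path[OF assms(1) ne sym W, where F = "\<lambda>a b. H b a"])
  also have "\<dots> = (\<Sum>b\<in>W. walks W H (Suc (length xs - 1)) b b)"
    by (subst sum.swap) simp
  also have "Suc (length xs - 1) = length xs" using assms(2) by simp
  finally show ?thesis .
qed

text \<open>The complete graphs for the degrees 0, 1 and 2 are the paths on one and two vertices and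
  the triangle.\<close>

lemma complete_edges_hom_weight:
  assumes "edge_weighted_graph W H"
  shows "hom_weight {..<1} (complete_edges 1) W H = (\<Sum>a\<in>W. \<Sum>b\<in>W. walks W H 0 a b)" (is ?K1)
    and "hom_weight {..<2} (complete_edges 2) W H = (\<Sum>a\<in>W. \<Sum>b\<in>W. walks W H 1 a b)" (is ?K2)
    and "hom_weight {..<3} (complete_edges 3) W H = (\<Sum>a\<in>W. walks W H 3 a a)" (is ?K3)
proof -
  have K1: "complete_edges 1 = path_edges [0]"
    by (auto simp: complete_edges_def card_2_iff)
  show ?K1 using hom_weight_path[of "[0::nat]", OF _ _ assms] unfolding K1 by (simp add: lessThan_Suc)
  have K2: "complete_edges 2 = path_edges [0, 1]"
    by (auto simp: complete_edges_def card_2_iff less_2_cases_iff insert_commute)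
  show ?K2 using hom_weight_path[of "[0::nat, 1]", OF _ _ assms] unfolding K2
    by (simp add: lessThan_Suc numeral_2_eq_2 insert_commute del: path_edges.simps walks.simps)
  have K3: "complete_edges 3 = insert {hd [0, 1, 2], last [0, 1, 2]} (path_edges [0, 1, 2])"
  proof (intro equalityI subsetI)
    fix e assume "e \<in> complete_edges 3"
    then obtain x y where "e = {x, y}" "x < 3" "y < 3" "x \<noteq> y" by (auto simp: complete_edges_def card_2_iff)
    moreover from this have "x = 0 \<or> x = 1 \<or> x = 2" "y = 0 \<or> y = 1 \<or> y = 2" by linarith+
    ultimately show "e \<in> insert {hd [0, 1, 2], last [0, 1, 2]} (path_edges [0, 1, 2])"
      by (elim disjE) (simp_all add: insert_commute)
  qed (auto simp: complete_edges_def)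
  have "{..<3} = set [0::nat, 1, 2]" by (simp add: lessThan_Suc numeral_3_eq_3 numeral_2_eq_2 insert_commute)
  thus ?K3 using hom_weight_cycle[of "[0::nat, 1, 2]", OF _ _ assms] unfolding K3
    by (simp add: numeral_3_eq_3 del: path_edges.simps walks.simps)
qed

section \<open>Spectral inequalities\<close>

text \<open>The columns of an orthogonal \<open>P\<close> are eigenvectors for the eigenvalues
  \<open>d k\<close>. The coefficient \<open>c k\<close> is the squared sum of the entries of column
  \<open>k\<close>, that is, the squared coordinate of the all-ones vector. In the traces the
  coefficients are 1 because the columns are unit vectors.\<close>

lemma walk_sums_spectral:
  fixes W :: "'b set"
  assumes "edge_weighted_graph W H"
  obtains d c :: "nat \<Rightarrow> real"
  where "num_pos_eigenvalues (weight_matrix W H) = card {i. i < card W \<and> d i > 0}"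
    and "\<And>m. (\<Sum>a\<in>W. walks W H m a a) = (\<Sum>k<card W. d k ^ m)"
    and "\<And>k. c k \<ge> 0"
    and "\<And>m. (\<Sum>a\<in>W. \<Sum>b\<in>W. walks W H m a b) = (\<Sum>k<card W. c k * d k ^ m)"
proof -
  define n where "n = card W"
  define f where "f = from_nat_into W"
  define A where "A = weight_matrix W H"
  have sym: "\<And>a b. a \<in> W \<Longrightarrow> b \<in> W \<Longrightarrow> H a b = H b a" and W: "finite W"
    using assms unfolding edge_weighted_graph_def by auto
  have f: "bij_betw f {..<n} W" unfolding f_def n_def by (rule bij_betw_from_nat_into_finite[OF W])
  have fW: "f i \<in> W" if "i < n" for i using f that by (auto simp: bij_betw_def)
  have sumW: "(\<Sum>a\<in>W. g a) = (\<Sum>i<n. g (f i))" for g :: "'b \<Rightarrow> real"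
    by (rule sum.reindex_bij_betw[OF f, symmetric])
  have A: "A \<in> carrier_mat n n" unfolding A_def weight_matrix_def n_def by simp
  have Aij: "A $$ (i, j) = H (f i) (f j)" if "i < n" "j < n" for i j
    using that unfolding A_def weight_matrix_def n_def f_def by simp
  have "transpose_mat A = A"
    by (rule eq_matI) (use A in \<open>auto simp: Aij sym fW\<close>)
  then obtain P d where P: "P \<in> carrier_mat n n" "transpose_mat P * P = 1\<^sub>m n"
    and AP: "A = P * mat_diag n d * transpose_mat P"
    using symmetric_mat_diagonalizable[OF A] by blast
  have T: "transpose_mat P \<in> carrier_mat n n" using P by simp
  have orth: "(\<Sum>i<n. P $$ (i, k) * P $$ (i, l)) = of_bool (k = l)" if "k < n" "l < n" for k l
  proof -
    have "(transpose_mat P * P) $$ (k, l) = (\<Sum>i<n. P $$ (i, k) * P $$ (i, l))"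
      using that P(1) by (simp add: scalar_prod_def atLeast0LessThan)
    moreover have "(transpose_mat P * P) $$ (k, l) = of_bool (k = l)" unfolding P(2) using that by simp
    ultimately show ?thesis by metis
  qed
  have orth': "(\<Sum>k<n. P $$ (i, k) * P $$ (j, k)) = of_bool (i = j)" if "i < n" "j < n" for i j
  proof -
    have "(P * transpose_mat P) $$ (i, j) = (\<Sum>k<n. P $$ (i, k) * P $$ (j, k))"
      using that P(1) by (simp add: scalar_prod_def atLeast0LessThan)
    moreover have "(P * transpose_mat P) $$ (i, j) = of_bool (i = j)"
      unfolding mat_mult_left_right_inverse[OF T P] using that by simp
    ultimately show ?thesis by metis
  qed
  have "A * P = P * mat_diag n d * (transpose_mat P * P)"
    unfolding AP using P(1) T by (intro assoc_mult_mat[of _ n n _ n _ n]) auto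
  also have "\<dots> = P * mat_diag n d" unfolding P(2) using P(1) by (intro right_mult_one_mat[of _ n n]) auto
  finally have AP': "A * P = P * mat_diag n d" .
  have eig: "(\<Sum>l<n. H (f i) (f l) * P $$ (l, k)) = d k * P $$ (i, k)" if "i < n" "k < n" for i k
  proof -
    have "(A * P) $$ (i, k) = (\<Sum>l<n. H (f i) (f l) * P $$ (l, k))"
      using that P(1) A by (simp add: scalar_prod_def atLeast0LessThan Aij)
    moreover have "(P * mat_diag n d) $$ (i, k) = P $$ (i, k) * d k"
      using that P(1) by (subst mat_diag_mult_right[of _ n]) auto
    ultimately show ?thesis unfolding AP' by (metis mult.commute)
  qed
  \<comment> \<open>The spectral decomposition of the \<open>m\<close>-th matrix power, entry by
    entry: each step of a walk multiplies the part belonging to column \<open>k\<close> by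
    \<open>d k\<close>, by \<open>eig\<close>.\<close>
  have walks: "walks W H m (f i) (f j) = (\<Sum>k<n. d k ^ m * (P $$ (i, k) * P $$ (j, k)))"
    if "i < n" "j < n" for m i j
    using that(1)
  proof (induction m arbitrary: i)
    case 0
    have "f i = f j \<longleftrightarrow> i = j" using f 0 that(2) by (auto simp: bij_betw_def inj_on_def)
    thus ?case using orth'[OF 0 that(2)] by simp
  next
    case (Suc m)
    have "walks W H (Suc m) (f i) (f j) =
        (\<Sum>l<n. \<Sum>k<n. H (f i) (f l) * (d k ^ m * (P $$ (l, k) * P $$ (j, k))))"
      unfolding walks.simps sumW by (intro sum.cong refl) (simp add: Suc.IH sum_distrib_left)
    also have "\<dots> = (\<Sum>k<n. \<Sum>l<n. H (f i) (f l) * (d k ^ m * (P $$ (l, k) * P $$ (j, k))))"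
      by (rule sum.swap)
    also have "\<dots> = (\<Sum>k<n. (\<Sum>l<n. H (f i) (f l) * P $$ (l, k)) * (d k ^ m * P $$ (j, k)))"
      by (simp add: sum_distrib_left sum_distrib_right mult_ac)
    also have "\<dots> = (\<Sum>k<n. d k ^ Suc m * (P $$ (i, k) * P $$ (j, k)))"
      using Suc.prems by (intro sum.cong refl) (simp add: eig)
    finally show ?case .
  qed
  have "num_pos_eigenvalues A = card {i. i < n \<and> d i > 0}"
    by (rule num_pos_eigenvalues_diagonalized[OF P AP])
  moreover have "(\<Sum>a\<in>W. walks W H m a a) = (\<Sum>k<n. d k ^ m)" for m
  proof -
    have "(\<Sum>a\<in>W. walks W H m a a) = (\<Sum>i<n. \<Sum>k<n. d k ^ m * (P $$ (i, k) * P $$ (i, k)))"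
      unfolding sumW by (intro sum.cong refl) (simp add: walks)
    also have "\<dots> = (\<Sum>k<n. d k ^ m * (\<Sum>i<n. P $$ (i, k) * P $$ (i, k)))"
      by (subst sum.swap) (simp add: sum_distrib_left)
    finally show ?thesis by (simp add: orth)
  qed
  moreover have "(\<Sum>a\<in>W. \<Sum>b\<in>W. walks W H m a b) = (\<Sum>k<n. (\<Sum>i<n. P $$ (i, k))\<^sup>2 * d k ^ m)" for m
  proof -
    have "(\<Sum>a\<in>W. \<Sum>b\<in>W. walks W H m a b) =
        (\<Sum>i<n. \<Sum>j<n. \<Sum>k<n. d k ^ m * (P $$ (i, k) * P $$ (j, k)))"
      unfolding sumW by (intro sum.cong refl) (simp add: walks)
    also have "\<dots> = (\<Sum>i<n. \<Sum>k<n. \<Sum>j<n. d k ^ m * (P $$ (i, k) * P $$ (j, k)))"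
      by (intro sum.cong refl sum.swap)
    also have "\<dots> = (\<Sum>k<n. \<Sum>i<n. \<Sum>j<n. d k ^ m * (P $$ (i, k) * P $$ (j, k)))"
      by (rule sum.swap)
    finally show ?thesis
      by (simp add: power2_eq_square sum_product sum_distrib_left sum_distrib_right mult_ac)
  qed
  ultimately show ?thesis
    using that[of d "\<lambda>k. (\<Sum>i<n. P $$ (i, k))\<^sup>2"] unfolding A_def n_def by simp
qed

text \<open>The two estimates of the overview, freed from matrices: the first serves a cycle with
  \<open>m\<close> vertices, the second a path with \<open>m + 2\<close> vertices.\<close>

lemma antiferromagnetic_power_sums:
  fixes d c :: "'i \<Rightarrow> real"
  assumes "finite I" and one: "card {i\<in>I. d i > 0} = 1"
    and t: "t \<ge> 0" "t ^ 3 = (\<Sum>i\<in>I. d i ^ 3)"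
  shows "m \<ge> 3 \<Longrightarrow> t ^ m \<le> (\<Sum>i\<in>I. d i ^ m)"
    and "(\<And>i. c i \<ge> 0) \<Longrightarrow> (\<Sum>i\<in>I. c i * d i) \<ge> 0 \<Longrightarrow> (\<Sum>i\<in>I. c i * d i) * t ^ m \<le> (\<Sum>i\<in>I. c i * d i ^ Suc m)"
proof -
  obtain p where p: "{i\<in>I. d i > 0} = {p}" using one card_1_singletonE by blast
  define J where "J = I - {p}"
  define x where "x = d p"
  define y where "y i = - d i" for i
  have x: "x > 0" and pI: "p \<in> I" using p unfolding x_def by auto
  have y0: "y i \<ge> 0" if "i \<in> J" for i using p that unfolding J_def y_def by force
  have J: "finite J" unfolding J_def using assms(1) by simp
  have split: "sum g I = g p + sum g J" for g :: "'i \<Rightarrow> real"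
    unfolding J_def using assms(1) pI by (rule sum.remove)
  have x3: "t ^ 3 + (\<Sum>i\<in>J. y i ^ 3) = x ^ 3"
    unfolding t(2) split y_def x_def by (simp add: sum_negf)
  have yx: "y i \<le> x" if "i \<in> J" for i
  proof -
    have "y i ^ 3 \<le> (\<Sum>i\<in>J. y i ^ 3)" using J y0 that by (intro member_le_sum) auto
    also have "\<dots> \<le> x ^ 3" using x3 t(1) zero_le_power[OF t(1), of 3] by linarith
    finally show ?thesis using x by (simp add: power_mono_iff y0[OF that])
  qed
  have tx: "t \<le> x"
  proof -
    have "(\<Sum>i\<in>J. y i ^ 3) \<ge> 0" using y0 by (intro sum_nonneg) auto
    hence "t ^ 3 \<le> x ^ 3" using x3 by linarith
    thus ?thesis using x t(1) by (simp add: power_mono_iff)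
  qed
  \<comment> \<open>For odd \<open>k\<close> this is an equality. For even \<open>k\<close> the left
    side is nonnegative and the right side is not positive, so even powers only help.\<close>
  have dy: "d i ^ k \<ge> - (y i ^ k)" for i k
    unfolding y_def by (cases "even k") (simp_all add: zero_le_even_power)
  show "t ^ m \<le> (\<Sum>i\<in>I. d i ^ m)" if m: "m \<ge> 3"
  proof -
    obtain k where k: "m = 3 + k" using m le_Suc_ex by blast
    have "t ^ m + (\<Sum>i\<in>J. y i ^ m) = t ^ 3 * t ^ k + (\<Sum>i\<in>J. y i ^ 3 * y i ^ k)"
      unfolding k power_add ..
    also have "\<dots> \<le> t ^ 3 * x ^ k + (\<Sum>i\<in>J. y i ^ 3 * x ^ k)"
      using y0 yx tx t(1) by (intro add_mono sum_mono mult_left_mono power_mono) auto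
    also have "\<dots> = x ^ m" unfolding k power_add x3[symmetric] by (simp add: distrib_right sum_distrib_right)
    finally have "t ^ m \<le> x ^ m + (\<Sum>i\<in>J. - (y i ^ m))" by (simp add: sum_negf)
    also have "\<dots> \<le> x ^ m + (\<Sum>i\<in>J. d i ^ m)" using dy by (intro add_left_mono sum_mono)
    finally show ?thesis unfolding split x_def .
  qed
  show "(\<Sum>i\<in>I. c i * d i) * t ^ m \<le> (\<Sum>i\<in>I. c i * d i ^ Suc m)"
    if c: "\<And>i. c i \<ge> 0" and s: "(\<Sum>i\<in>I. c i * d i) \<ge> 0"
  proof -
    have s': "(\<Sum>i\<in>J. c i * y i) \<le> c p * x" using s unfolding split y_def x_def by (simp add: sum_negf)
    have "(\<Sum>i\<in>J. c i * y i * (y i ^ m - t ^ m)) \<le> (\<Sum>i\<in>J. c i * y i * (x ^ m - t ^ m))"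
      using c y0 yx by (intro sum_mono mult_left_mono diff_right_mono power_mono) auto
    \<comment> \<open>The common factor \<open>x ^ m - t ^ m\<close> is nonnegative by
      \<open>tx\<close>, so \<open>s'\<close> can be multiplied by it.\<close>
    also have "\<dots> \<le> c p * x * (x ^ m - t ^ m)"
      unfolding sum_distrib_right[symmetric] using s' tx t(1) by (intro mult_right_mono) (auto simp: power_mono)
    finally have "c p * x * t ^ m - (\<Sum>i\<in>J. c i * y i) * t ^ m \<le> c p * x ^ Suc m + (\<Sum>i\<in>J. c i * - (y i ^ Suc m))"
      by (simp add: algebra_simps sum_subtractf sum_negf sum_distrib_right sum_distrib_left)
    also have "\<dots> \<le> c p * x ^ Suc m + (\<Sum>i\<in>J. c i * d i ^ Suc m)"
      using dy c by (intro add_left_mono sum_mono mult_left_mono)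
    finally show ?thesis unfolding split y_def x_def by (simp add: algebra_simps sum_negf sum_distrib_right)
  qed
qed

section \<open>Components of graphs of maximum degree two\<close>

lemma path_edges_Cons: "xs \<noteq> [] \<Longrightarrow> path_edges (w # xs) = insert {w, hd xs} (path_edges xs)"
  by (cases xs) auto

lemma path_edges_snoc: "xs \<noteq> [] \<Longrightarrow> path_edges (xs @ [w]) = insert {last xs, w} (path_edges xs)"
  by (induction xs rule: path_edges.induct) auto

lemma degree_le_2_neighbours:
  assumes "finite E" and "vertex_degree E v \<le> 2"
    and "{v, a} \<in> E" and "{v, b} \<in> E" and "{v, c} \<in> E" and "distinct [a, b, c]"
  shows False
proof -
  have "card {{v, a}, {v, b}, {v, c}} \<le> card {e \<in> E. v \<in> e}"
    using assms by (intro card_mono) auto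
  moreover have "distinct [{v, a}, {v, b}, {v, c}]" using assms(6) by (auto simp: doubleton_eq_iff)
  hence "card {{v, a}, {v, b}, {v, c}} = 3" using distinct_card by fastforce
  ultimately show False using assms(2) unfolding vertex_degree_def by simp
qed

text \<open>A longest path is a whole component up to its closing edge: its ends have no neighbour
  off the path by maximality, and its inner vertices have used up their degree 2.\<close>

lemma path_or_cycle_component:
  assumes "simple_graph V E" and deg: "\<And>v. v \<in> V \<Longrightarrow> vertex_degree E v \<le> 2" and "V \<noteq> {}"
  obtains xs where "xs \<noteq> []" and "distinct xs" and "set xs \<subseteq> V"
    and "{e \<in> E. e \<inter> set xs \<noteq> {}} = path_edges xs \<or>
      length xs \<ge> 3 \<and> {e \<in> E. e \<inter> set xs \<noteq> {}} = insert {hd xs, last xs} (path_edges xs)"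
proof -
  have V: "finite V" and edge: "\<And>e. e \<in> E \<Longrightarrow> e \<subseteq> V \<and> card e = 2"
    using assms(1) unfolding simple_graph_def by auto
  have E: "finite E" by (rule finite_subset[of _ "Pow V"]) (use V edge in auto)
  let ?path = "\<lambda>xs. xs \<noteq> [] \<and> distinct xs \<and> set xs \<subseteq> V \<and> path_edges xs \<subseteq> E"
  obtain v where "v \<in> V" using \<open>V \<noteq> {}\<close> by blast
  hence "?path [v]" by simp
  moreover have "\<forall>xs. ?path xs \<longrightarrow> length xs < Suc (card V)"
  proof (intro allI impI)
    fix xs assume "?path xs"
    thus "length xs < Suc (card V)" using card_mono[OF V, of "set xs"] distinct_card[of xs] by simp
  qed
  ultimately obtain xs where "?path xs" and longest: "\<And>ys. ?path ys \<Longrightarrow> length ys \<le> length xs"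
    using ex_has_greatest_nat[of ?path "[v]" length "Suc (card V)"] by metis
  hence ne: "xs \<noteq> []" and dist: "distinct xs" and sub: "set xs \<subseteq> V" and pe: "path_edges xs \<subseteq> E" by auto
  let ?n = "length xs"
  have cons: "{xs ! i, xs ! Suc i} \<in> E" if "Suc i < ?n" for i
    using that pe by (auto simp: path_edges_conv_nth)
  have nthV: "xs ! i \<in> V" if "i < ?n" for i using that sub by auto
  \<comment> \<open>An inner vertex already has its two path neighbours.\<close>
  have three: False
    if "Suc i < ?n" "0 < i" "{xs ! i, w} \<in> E" "w \<noteq> xs ! (i - 1)" "w \<noteq> xs ! Suc i" for i w
  proof (rule degree_le_2_neighbours[OF E deg])
    show "{xs ! i, xs ! (i - 1)} \<in> E" using cons[of "i - 1"] that by (simp add: insert_commute)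
    show "distinct [xs ! (i - 1), xs ! Suc i, w]"
      using that dist by (auto simp: nth_eq_iff_index_eq)
  qed (use that nthV cons in auto)
  \<comment> \<open>Any other chord has an inner vertex among its ends: \<open>xs ! i\<close> if
    \<open>i > 0\<close>, and \<open>xs ! j\<close> if \<open>i = 0\<close>, since then
    \<open>j\<close> is not the last index.\<close>
  have chord: "j = Suc i \<or> i = 0 \<and> j = ?n - 1" if "i < j" "j < ?n" "{xs ! i, xs ! j} \<in> E" for i j
  proof (rule ccontr)
    assume *: "\<not> ?thesis"
    show False
    proof (cases "i = 0")
      case False
      show False by (rule three[of i "xs ! j"]) (use False that * dist in \<open>auto simp: nth_eq_iff_index_eq\<close>)
    next
      case True
      have "Suc j < ?n" using True * that(2) by linarith
      thus False
        by (intro three[of j "xs ! i"])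
          (use True that * dist ne nth_eq_iff_index_eq[OF dist, of 0 "j - 1"] nth_eq_iff_index_eq[OF dist, of 0 "Suc j"]
            in \<open>auto simp: insert_commute\<close>)
    qed
  qed
  have outside: "w \<in> set xs" if "{xs ! i, w} \<in> E" "i < ?n" for i w
  proof (rule ccontr)
    assume w: "w \<notin> set xs"
    have wV: "w \<in> V" using edge[OF that(1)] by auto
    have "i = 0 \<or> i = ?n - 1 \<or> 0 < i \<and> Suc i < ?n" using that(2) by linarith
    then consider "i = 0" | "i = ?n - 1" | "0 < i" "Suc i < ?n" by blast
    thus False
    proof cases
      case 1
      hence "?path (w # xs)" using w wV that ne dist sub pe
        by (auto simp: path_edges_Cons hd_conv_nth insert_commute)
      thus False using longest[of "w # xs"] by simp
    next
      case 2
      hence "?path (xs @ [w])" using w wV that ne dist sub pe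
        by (auto simp: path_edges_snoc last_conv_nth)
      thus False using longest[of "xs @ [w]"] by simp
    next
      case 3
      have "xs ! (i - 1) \<in> set xs" "xs ! Suc i \<in> set xs" using 3 by auto
      thus False using three[OF 3(2,1) that(1)] w by metis
    qed
  qed
  have hd_last: "hd xs = xs ! 0" "last xs = xs ! (?n - 1)" using ne by (auto simp: hd_conv_nth last_conv_nth)
  have incident: "e \<in> path_edges xs \<or> ?n \<ge> 3 \<and> e = {hd xs, last xs}"
    if eE: "e \<in> E" and eX: "e \<inter> set xs \<noteq> {}" for e
  proof -
    obtain v where v: "v \<in> e" "v \<in> set xs" using eX by blast
    then obtain w where e: "e = {v, w}" "v \<noteq> w"
      using edge[OF eE] by (auto simp: card_2_iff)
    obtain i where i: "i < ?n" "v = xs ! i" using v(2) by (metis in_set_conv_nth)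
    have "w \<in> set xs" using outside[of i w] eE e(1) i by simp
    then obtain j where j: "j < ?n" "w = xs ! j" by (metis in_set_conv_nth)
    have "\<exists>k l. k < l \<and> l < ?n \<and> e = {xs ! k, xs ! l}"
      using i j e by (cases i j rule: linorder_cases) (auto simp: insert_commute)
    then obtain k l where kl: "k < l" "l < ?n" "e = {xs ! k, xs ! l}" by blast
    have "l = Suc k \<or> k = 0 \<and> l = ?n - 1" using chord[OF kl(1,2)] eE kl(3) by simp
    then consider "l = Suc k" | "k = 0" "l = ?n - 1" "l \<noteq> Suc k" by blast
    thus ?thesis
    proof cases
      case 1
      thus ?thesis using kl by (auto simp: path_edges_conv_nth)
    next
      case 2
      \<comment> \<open>On two vertices the closing edge would be the path edge itself, which the
        case \<open>l = Suc k\<close> covers.\<close>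
      hence "?n \<ge> 3" using kl(1,2) by linarith
      thus ?thesis using 2 kl(3) by (simp add: hd_last)
    qed
  qed
  have sup: "path_edges xs \<subseteq> {e \<in> E. e \<inter> set xs \<noteq> {}}"
  proof
    fix e assume e: "e \<in> path_edges xs"
    then obtain i where "Suc i < ?n" "e = {xs ! i, xs ! Suc i}" by (auto simp: path_edges_conv_nth)
    thus "e \<in> {e \<in> E. e \<inter> set xs \<noteq> {}}" using e pe nth_mem[of i xs] by auto
  qed
  have "{e \<in> E. e \<inter> set xs \<noteq> {}} = path_edges xs \<or>
      ?n \<ge> 3 \<and> {e \<in> E. e \<inter> set xs \<noteq> {}} = insert {hd xs, last xs} (path_edges xs)"
    using incident sup by blast
  thus ?thesis using that ne dist sub by blast
qed

section \<open>Degrees along paths and cycles\<close>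

lemma vertex_degree_path:
  assumes "distinct xs" and "i < length xs"
  shows "vertex_degree (path_edges xs) (xs ! i) = of_bool (0 < i) + of_bool (Suc i < length xs)"
proof -
  have "{e \<in> path_edges xs. xs ! i \<in> e} =
      (if 0 < i then {{xs ! (i - 1), xs ! i}} else {}) \<union> (if Suc i < length xs then {{xs ! i, xs ! Suc i}} else {})"
    (is "?L = ?R")
  proof (intro equalityI subsetI)
    fix e assume "e \<in> ?L"
    then obtain j where j: "Suc j < length xs" "e = {xs ! j, xs ! Suc j}" "xs ! i \<in> e"
      by (auto simp: path_edges_conv_nth)
    hence "i = j \<or> i = Suc j" using assms by (auto simp: nth_eq_iff_index_eq)
    thus "e \<in> ?R" using j by auto
  next
    fix e assume "e \<in> ?R"
    hence "0 < i \<and> e = {xs ! (i - 1), xs ! Suc (i - 1)} \<or> Suc i < length xs \<and> e = {xs ! i, xs ! Suc i}"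
      by (auto split: if_splits)
    thus "e \<in> ?L" unfolding path_edges_conv_nth using assms(2) by auto
  qed
  moreover have "{xs ! (i - 1), xs ! i} \<noteq> {xs ! i, xs ! Suc i}" if "0 < i" "Suc i < length xs"
    using that assms by (auto simp: doubleton_eq_iff nth_eq_iff_index_eq)
  ultimately show ?thesis
    unfolding vertex_degree_def by (cases "0 < i"; cases "Suc i < length xs") simp_all
qed

text \<open>Two ends of degree 1 and \<open>m\<close> inner vertices of degree 2. A path on one
  vertex is excluded, as its vertex has degree 0.\<close>

lemma prod_path_degrees:
  fixes g :: "nat \<Rightarrow> real"
  assumes "distinct xs" and "length xs = Suc (Suc m)"
  shows "(\<Prod>v\<in>set xs. g (vertex_degree (path_edges xs) v)) = g 1 * g 1 * g 2 ^ m"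
proof -
  have "(\<Prod>v\<in>set xs. g (vertex_degree (path_edges xs) v)) =
      (\<Prod>i<Suc (Suc m). g (vertex_degree (path_edges xs) (xs ! i)))"
    using assms by (intro prod.reindex_bij_betw[symmetric] bij_betw_nth) auto
  also have "\<dots> = (\<Prod>i<Suc (Suc m). g (of_bool (0 < i) + of_bool (i < Suc m)))"
    using assms by (intro prod.cong refl) (simp add: vertex_degree_path)
  also have "\<dots> = g 1 * g 1 * (\<Prod>i<m. g (1 + of_bool (i < m)))"
    unfolding prod.lessThan_Suc_shift[where n = "Suc m"] by simp
  also have "(\<Prod>i<m. g (1 + of_bool (i < m))) = (\<Prod>i<m. g 2)"
    by (intro prod.cong) (auto simp: numeral_2_eq_2)
  finally show ?thesis by simp
qed

text \<open>The closing edge raises the degree of both ends from 1 to 2.\<close>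

lemma prod_cycle_degrees:
  fixes g :: "nat \<Rightarrow> real"
  assumes "distinct xs" and "length xs \<ge> 3"
  shows "(\<Prod>v\<in>set xs. g (vertex_degree (insert {hd xs, last xs} (path_edges xs)) v)) = g 2 ^ length xs"
proof -
  let ?c = "{hd xs, last xs}"
  have hd_last: "hd xs = xs ! 0" "last xs = xs ! (length xs - 1)"
    using assms(2) hd_conv_nth[of xs] last_conv_nth[of xs] by (cases xs; simp)+
  have "vertex_degree (insert ?c (path_edges xs)) v = 2" if "v \<in> set xs" for v
  proof -
    from that obtain i where i: "i < length xs" "v = xs ! i" by (metis in_set_conv_nth)
    have c: "v \<in> ?c \<longleftrightarrow> i = 0 \<or> i = length xs - 1"
    proof -
      have "0 < length xs" "length xs - 1 < length xs" using assms(2) by auto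
      thus ?thesis unfolding hd_last i(2) using assms i by (simp add: nth_eq_iff_index_eq)
    qed
    have "{e \<in> insert ?c (path_edges xs). v \<in> e} =
        (if v \<in> ?c then insert ?c {e \<in> path_edges xs. v \<in> e} else {e \<in> path_edges xs. v \<in> e})" by auto
    hence "vertex_degree (insert ?c (path_edges xs)) v = of_bool (v \<in> ?c) + vertex_degree (path_edges xs) v"
      unfolding vertex_degree_def using closing_edge_notin_path_edges[OF assms] by simp
    also have "\<dots> = 2"
      unfolding c unfolding i(2) vertex_degree_path[OF assms(1) i(1)] using i(1) assms(2) by auto
    finally show ?thesis .
  qed
  thus ?thesis using assms(1) by (simp add: distinct_card)
qed

section \<open>The bound for one component, and induction over components\<close>

lemma component_bound:
  fixes H :: "'b \<Rightarrow> 'b \<Rightarrow> real"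
  defines "K \<equiv> \<lambda>W d. hom_weight {..<d + 1} (complete_edges (d + 1)) W H powr (1 / real (d + 1))"
  assumes H: "edge_weighted_graph W H" and af: "antiferromagnetic W H"
    and xs: "xs \<noteq> []" "distinct xs"
    and F: "F = path_edges xs \<or> length xs \<ge> 3 \<and> F = insert {hd xs, last xs} (path_edges xs)"
  shows "(\<Prod>v\<in>set xs. K W (vertex_degree F v)) \<le> hom_weight (set xs) F W H"
proof -
  obtain d c where num: "num_pos_eigenvalues (weight_matrix W H) = card {i. i < card W \<and> d i > 0}"
    and tr: "\<And>m. (\<Sum>a\<in>W. walks W H m a a) = (\<Sum>k<card W. d k ^ m)"
    and c: "\<And>k. c k \<ge> 0"
    and sm: "\<And>m. (\<Sum>a\<in>W. \<Sum>b\<in>W. walks W H m a b) = (\<Sum>k<card W. c k * d k ^ m)"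
    using walk_sums_spectral[OF H] by blast
  have one: "card {i \<in> {..<card W}. d i > 0} = 1"
    using af num unfolding antiferromagnetic_def by simp
  have nn: "walks W H m a b \<ge> 0" if "a \<in> W" for m a b
    using H that unfolding edge_weighted_graph_def by (intro walks_nonneg) auto
  have tr0: "(\<Sum>a\<in>W. walks W H m a a) \<ge> 0" and sm0: "(\<Sum>a\<in>W. \<Sum>b\<in>W. walks W H m a b) \<ge> 0" for m
    by (intro sum_nonneg nn; assumption)+
  note ce = complete_edges_hom_weight[OF H]
  have K0: "K W 0 = (\<Sum>a\<in>W. \<Sum>b\<in>W. walks W H 0 a b)"
    using ce(1) sm0[of 0] unfolding K_def by (simp del: walks.simps)
  have "K W 1 = (\<Sum>a\<in>W. \<Sum>b\<in>W. walks W H 1 a b) powr (1 / 2)"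
    using ce(2) unfolding K_def by (simp del: walks.simps add: numeral_2_eq_2)
  \<comment> \<open>Each end of a path contributes a square root of the total weight, so both
    together contribute the sum of all matrix entries.\<close>
  hence K1: "K W 1 * K W 1 = (\<Sum>a\<in>W. \<Sum>b\<in>W. walks W H 1 a b)"
    using sm0[of 1] by (simp del: walks.simps add: powr_half_sqrt)
  have "K W 2 = (\<Sum>a\<in>W. walks W H 3 a a) powr (1 / 3)"
    using ce(3) unfolding K_def by (simp del: walks.simps add: numeral_3_eq_3 numeral_2_eq_2)
  \<comment> \<open>\<open>K W 2\<close> is the \<open>t\<close> of the overview, the nonnegative
    cube root of the trace of the third power.\<close>
  hence K2: "K W 2 \<ge> 0" "K W 2 ^ 3 = (\<Sum>a\<in>W. walks W H 3 a a)"
    using tr0[of 3] by (cases "(\<Sum>a\<in>W. walks W H 3 a a) = 0"; simp add: powr_power del: walks.simps)+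
  note ineq = antiferromagnetic_power_sums[OF finite_lessThan one K2(1) K2(2)[unfolded tr]]
  consider "length xs = 1" "F = path_edges xs" | m where "length xs = Suc (Suc m)" "F = path_edges xs"
    | "length xs \<ge> 3" "F = insert {hd xs, last xs} (path_edges xs)"
    using F xs(1) by (metis One_nat_def length_0_conv not0_implies_Suc)
  thus ?thesis
  proof cases
    case 1
    then obtain x where x: "xs = [x]" by (auto simp: length_Suc_conv)
    have "vertex_degree {} x = 0" by (simp add: vertex_degree_def)
    thus ?thesis using hom_weight_path[OF xs(2,1) H] K0 unfolding 1 x by simp
  next
    case 2
    have "(\<Prod>v\<in>set xs. K W (vertex_degree F v)) = (\<Sum>k<card W. c k * d k) * K W 2 ^ m"
      unfolding 2(2) prod_path_degrees[OF xs(2) 2(1)] K1 sm by simp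
    also have "\<dots> \<le> (\<Sum>k<card W. c k * d k ^ Suc m)"
      using c sm0[of 1] unfolding sm by (intro ineq(2)) auto
    also have "\<dots> = hom_weight (set xs) F W H"
      unfolding 2(2) hom_weight_path[OF xs(2,1) H] sm using 2(1) by simp
    finally show ?thesis .
  next
    case 3
    show ?thesis
      unfolding 3(2) prod_cycle_degrees[OF xs(2) 3(1)] hom_weight_cycle[OF xs(2) 3(1) H] tr
      using ineq(1)[OF 3(1)] .
  qed
qed

theorem theorem4p1:
  fixes V :: "'a set" and E :: "'a set set"
    and W :: "'b set" and H :: "'b \<Rightarrow> 'b \<Rightarrow> real"
  assumes "simple_graph V E"
    and "max_degree V E \<le> 2"
    and "edge_weighted_graph W H"
    and "antiferromagnetic W H"
  shows "hom_weight V E W H \<ge>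
    (\<Prod>v\<in>V. hom_weight {..<vertex_degree E v + 1} (complete_edges (vertex_degree E v + 1)) W H
                     powr (1 / real (vertex_degree E v + 1)))"
proof -
  define K where "K d = hom_weight {..<d + 1} (complete_edges (d + 1)) W H powr (1 / real (d + 1))" for d
  have K0: "K d \<ge> 0" for d unfolding K_def by simp
  have "vertex_degree E v \<le> 2" if "v \<in> V" for v
  proof -
    have "finite V" using assms(1) unfolding simple_graph_def by simp
    thus ?thesis using that assms(2) unfolding max_degree_def by simp
  qed
  with assms(1) have "(\<Prod>v\<in>V. K (vertex_degree E v)) \<le> hom_weight V E W H"
  \<comment> \<open>Removing a whole component leaves fewer vertices and does not change the degrees
    of those that remain.\<close>
  proof (induction "card V" arbitrary: V E rule: less_induct)
    case less
    have V: "finite V" and edge: "\<And>e. e \<in> E \<Longrightarrow> e \<subseteq> V \<and> card e = 2"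
      using less.prems(1) unfolding simple_graph_def by auto
    have E: "finite E" by (rule finite_subset[of _ "Pow V"]) (use V edge in auto)
    show ?case
    proof (cases "V = {}")
      case True
      hence "E = {}" using edge by fastforce
      \<comment> \<open>Both sides are 1: the only map on the empty set is \<open>undefined\<close>
        everywhere, and its product over no edges is 1.\<close>
      thus ?thesis using True by (simp add: hom_weight_def)
    next
      case False
      obtain xs where xs: "xs \<noteq> []" "distinct xs" "set xs \<subseteq> V"
        and comp: "{e \<in> E. e \<inter> set xs \<noteq> {}} = path_edges xs \<or>
          length xs \<ge> 3 \<and> {e \<in> E. e \<inter> set xs \<noteq> {}} = insert {hd xs, last xs} (path_edges xs)"
        by (rule path_or_cycle_component[OF less.prems False])
      define E1 where "E1 = {e \<in> E. e \<inter> set xs \<noteq> {}}"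
      define E2 where "E2 = {e \<in> E. e \<inter> set xs = {}}"
      define U where "U = V - set xs"
      have VU: "V = set xs \<union> U" "set xs \<inter> U = {}" and EE: "E = E1 \<union> E2"
        unfolding U_def E1_def E2_def using xs(3) by auto
      \<comment> \<open>An edge that meets the component lies inside it, so \<open>E1\<close> and
        \<open>E2\<close> live on disjoint vertex sets and each vertex has all its edges in one of
        them.\<close>
      have E1: "E1 \<subseteq> Pow (set xs)"
        using comp path_edges_subset xs(1) unfolding E1_def[symmetric] by auto
      have E2: "E2 \<subseteq> Pow U" unfolding E2_def U_def using edge by auto
      have d1: "vertex_degree E v = vertex_degree E1 v" if "v \<in> set xs" for v
        unfolding vertex_degree_def E1_def using that by (intro arg_cong[where f = card]) auto
      have d2: "vertex_degree E v = vertex_degree E2 v" if "v \<in> U" for v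
        unfolding vertex_degree_def EE using that E1 VU(2) by (intro arg_cong[where f = card]) auto
      have "card U < card V" unfolding U_def using V xs by (intro psubset_card_mono) (auto simp: neq_Nil_conv)
      moreover have "simple_graph U E2" using V E2 edge unfolding simple_graph_def U_def E2_def by auto
      moreover have "vertex_degree E2 v \<le> 2" if "v \<in> U" for v
        using less.prems(2)[of v] d2[OF that] that VU(1) by simp
      ultimately have IH: "(\<Prod>v\<in>U. K (vertex_degree E2 v)) \<le> hom_weight U E2 W H"
        by (rule less.hyps)
      have "(\<Prod>v\<in>V. K (vertex_degree E v)) =
          (\<Prod>v\<in>set xs. K (vertex_degree E1 v)) * (\<Prod>v\<in>U. K (vertex_degree E2 v))"
        unfolding VU(1) using VU(2) V by (subst prod.union_disjoint) (auto simp: U_def d1 d2)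
      also have "\<dots> \<le> hom_weight (set xs) E1 W H * hom_weight U E2 W H"
      proof (rule mult_mono')
        show "(\<Prod>v\<in>set xs. K (vertex_degree E1 v)) \<le> hom_weight (set xs) E1 W H"
          unfolding K_def by (rule component_bound[OF assms(3,4) xs(1,2) comp[folded E1_def]])
      qed (use IH K0 in \<open>auto intro: prod_nonneg\<close>)
      also have "\<dots> = hom_weight (set xs \<union> U) (E1 \<union> E2) W H"
        using VU(2) E1 E2 E by (intro hom_weight_Un[symmetric]) (auto simp: E1_def E2_def)
      finally show ?thesis unfolding VU(1)[symmetric] EE[symmetric] .
    qed
  qed
  thus ?thesis unfolding K_def .
qed

end
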